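(* Let $X$ be a log-concave random variable taking values in $\mathbb{Z}$, with probability mass function $p(k)=\mathbb{P}(X=k)$, and let $M(X)=\max_{z\in\mathbb{Z}} p(z)$. Then $$M(X)^2\,\operatorname{Var}(X)+M(X)\leq 1.$$
   Context: A sequence $(a(k))_{k\in\mathbb{Z}}$ of nonnegative real numbers is called log-concave if $\{k\in\mathbb{Z}: a(k)>0\}$ is a discrete interval (a set of consecutive integers, possibly infinite) and $a(k)^2\geq a(k+1)a(k-1)$ for all $k\in\mathbb{Z}$. A $\mathbb{Z}$-valued random variable $X$ is log-concave if its probability mass function $p$ is a log-concave sequence. $\operatorname{Var}(X)$ denotes the variance of $X$. *)

theory Defs
  imports "HOL-Probability.Probability"
begin

text \<open>Order-convexity in the integers: this covers finite, one-sided infinite and two-sided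
  infinite sets of consecutive integers (and the empty set).\<close>

definition discrete_interval :: "int set \<Rightarrow> bool" where
  "discrete_interval S \<longleftrightarrow> (\<forall>i\<in>S. \<forall>k\<in>S. \<forall>j. i \<le> j \<and> j \<le> k \<longrightarrow> j \<in> S)"

definition log_concave_seq :: "(int \<Rightarrow> real) \<Rightarrow> bool" where
  "log_concave_seq a \<longleftrightarrow>
     (\<forall>k. a k \<ge> 0) \<and>
     discrete_interval {k. a k > 0} \<and>
     (\<forall>k. (a k)\<^sup>2 \<ge> a (k + 1) * a (k - 1))"

definition prob_mass :: "'a measure \<Rightarrow> ('a \<Rightarrow> int) \<Rightarrow> int \<Rightarrow> real" where
  "prob_mass M X k = \<P>(\<omega> in M. X \<omega> = k)"

definition log_concave_rv :: "'a measure \<Rightarrow> ('a \<Rightarrow> int) \<Rightarrow> bool" where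
  "log_concave_rv M X \<longleftrightarrow> log_concave_seq (prob_mass M X)"

text \<open>The greatest value of the mass function. \<^const>\<open>Max\<close> does not apply, as the set of values
  may be infinite. The maximum exists for every integer-valued random variable, since the masses
  are summable.\<close>

definition max_mass :: "'a measure \<Rightarrow> ('a \<Rightarrow> int) \<Rightarrow> real" where
  "max_mass M X = (GREATEST x. x \<in> range (prob_mass M X))"

end

theory Submission
  imports Defs
begin

text \<open>
  Let \<open>m\<close> be the mass \<open>p 0\<close> at a point of the support, which may be taken to be \<open>0\<close>, and cut the
  distribution there into the two sequences \<open>a j = p j\<close> and \<open>b j = p (- j)\<close> on the natural
  numbers, with sums \<open>A\<close> and \<open>B\<close>. The point \<open>0\<close> is counted twice, so \<open>A + B = 1 + m\<close>.

  Each half is compared with the geometric sequence of the same first term and the same sum. The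
  comparison rests on one principle: forming tail sums preserves log-concavity, and a log-concave
  sequence \<open>u\<close> with tail sums \<open>T k = u k + u (k + 1) + \<dots>\<close> satisfies \<open>u 0 * T k \<le> T 0 * u k\<close>.
  Summing the latter over \<open>k\<close> gives \<open>u 0 * (\<Sum>k. T k) \<le> (\<Sum>k. u k)\<^sup>2\<close>. Applied to \<open>a\<close> it
  bounds the first moment \<open>s\<close> of \<open>a\<close>, and applied to the tail sums of \<open>a\<close> it bounds the second
  moment \<open>Q\<close> in terms of \<open>s\<close>:
  \<open>m * s \<le> A * (A - m)\<close> and \<open>A * Q \<le> 2 * s\<^sup>2 + A * s\<close>, both with equality in the geometric case
  (\<open>log_concave_nat_moments\<close>). It also shows on the way that these moments are finite. With \<open>t\<close> and
  \<open>R\<close> the moments of \<open>b\<close>, the variance is \<open>Q + R - (s - t)\<^sup>2\<close>.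

  What remains is an inequality between real numbers (\<open>two_sided_bound\<close>). After \<open>Q\<close> and \<open>R\<close> are
  replaced by their bounds, the variance becomes a quadratic polynomial in \<open>s\<close> and \<open>t\<close> whose
  coefficients are all nonnegative: the terms \<open>2 * s\<^sup>2 / A\<close> and \<open>2 * t\<^sup>2 / B\<close> outweigh the
  \<open>- s\<^sup>2\<close> and \<open>- t\<^sup>2\<close> of the squared mean since \<open>A \<le> 1\<close> and \<open>B \<le> 1\<close>, and the mixed term
  \<open>2 * s * t\<close> enters with a plus sign. So the worst case is that of maximal \<open>s\<close> and
  \<open>t\<close>, the two-sided geometric distribution, for which the value multiplied by \<open>m\<^sup>2\<close> is
  \<open>\<alpha> + \<beta> - 2 * \<alpha> * \<beta>\<close> with \<open>\<alpha> = A - m\<close> and \<open>\<beta> = B - m\<close>; this is at most \<open>\<alpha> + \<beta> = 1 - m\<close>.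
\<close>

section \<open>Log-concave sequences on the natural numbers\<close>

text \<open>The condition \<open>a m * a (m + i + k) \<le> a (m + i) * a (m + k)\<close> says that the ratio
  \<open>a (j + i) / a j\<close> is antitone in \<open>j\<close>, without dividing. Unlike the inequality between three
  neighbours it also rules out gaps in the support, and it compares whole sums over \<open>i\<close> or \<open>k\<close>.\<close>

definition log_concave_nat :: "(nat \<Rightarrow> real) \<Rightarrow> bool" where
  "log_concave_nat a \<longleftrightarrow>
     (\<forall>k. 0 \<le> a k) \<and> (\<forall>m i k. a m * a (m + i + k) \<le> a (m + i) * a (m + k))"

lemma log_concave_natD:
  assumes "log_concave_nat a"
  shows "0 \<le> a k" and "a m * a (m + i + k) \<le> a (m + i) * a (m + k)"
  using assms unfolding log_concave_nat_def by blast+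

text \<open>The inequality between neighbours bounds successive ratios; multiplying these along a run of
  positive terms gives the inequality at arbitrary distances. If one of the outer terms vanishes
  there is nothing to prove, and otherwise the absence of gaps makes all terms between them
  positive, so that they can be cancelled.\<close>

lemma log_concave_natI_local:
  fixes a :: "nat \<Rightarrow> real"
  assumes nonneg: "\<And>k. 0 \<le> a k"
    and local_ineq: "\<And>k. a k * a (k + 2) \<le> (a (k + 1))\<^sup>2"
    and no_gap: "\<And>i j k. 0 < a i \<Longrightarrow> 0 < a k \<Longrightarrow> i \<le> j \<Longrightarrow> j \<le> k \<Longrightarrow> 0 < a j"
  shows "log_concave_nat a"
proof -
  have one: "a m * a (m + i + 1) \<le> a (m + i) * a (m + 1)" for m i
  proof (induction i)
    case 0
    then show ?case by simp
  next
    case (Suc i)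
    show ?case
    proof (cases "0 < a m \<and> 0 < a (m + Suc i + 1)")
      case False
      then have "a m * a (m + Suc i + 1) = 0"
        using nonneg[of m] nonneg[of "m + Suc i + 1"] by auto
      moreover have "0 \<le> a (m + Suc i) * a (m + 1)" by (intro mult_nonneg_nonneg nonneg)
      ultimately show ?thesis by (simp only:)
    next
      case True
      have pos: "0 < a (m + i)" by (rule no_gap[of m "m + Suc i + 1"]) (use True in auto)
      have "a m * (a (m + i) * a (m + i + 2)) \<le> a m * (a (m + i + 1))\<^sup>2"
        by (intro mult_left_mono local_ineq nonneg)
      also have "\<dots> = (a m * a (m + i + 1)) * a (m + i + 1)"
        by (simp add: power2_eq_square)
      also have "\<dots> \<le> (a (m + i) * a (m + 1)) * a (m + i + 1)"
        by (intro mult_right_mono Suc nonneg)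
      finally have "a (m + i) * (a m * a (m + i + 2)) \<le> a (m + i) * (a (m + i + 1) * a (m + 1))"
        by (simp add: ac_simps)
      with pos show ?thesis by simp
    qed
  qed
  have "a m * a (m + i + k) \<le> a (m + i) * a (m + k)" for m i k
  proof (induction k)
    case 0
    then show ?case by simp
  next
    case (Suc k)
    show ?case
    proof (cases "0 < a m \<and> 0 < a (m + i + Suc k)")
      case False
      then have "a m * a (m + i + Suc k) = 0"
        using nonneg[of m] nonneg[of "m + i + Suc k"] by auto
      moreover have "0 \<le> a (m + i) * a (m + Suc k)" by (intro mult_nonneg_nonneg nonneg)
      ultimately show ?thesis by (simp only:)
    next
      case True
      have pos: "0 < a (m + k)" by (rule no_gap[of m "m + i + Suc k"]) (use True in auto)
      have "a m * (a (m + k) * a (m + k + i + 1)) \<le> a m * (a (m + k + i) * a (m + k + 1))"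
        by (intro mult_left_mono one nonneg)
      also have "\<dots> = (a m * a (m + i + k)) * a (m + k + 1)"
        by (simp add: ac_simps)
      also have "\<dots> \<le> (a (m + i) * a (m + k)) * a (m + k + 1)"
        by (intro mult_right_mono Suc nonneg)
      finally have "a (m + k) * (a m * a (m + i + Suc k)) \<le> a (m + k) * (a (m + i) * a (m + Suc k))"
        by (simp add: ac_simps)
      with pos show ?thesis by simp
    qed
  qed
  with nonneg show ?thesis unfolding log_concave_nat_def by blast
qed

section \<open>Tail sums and summation by parts\<close>

definition tail :: "(nat \<Rightarrow> real) \<Rightarrow> nat \<Rightarrow> real" where
  "tail a k = (\<Sum>j. a (k + j))"

lemma tail_0: "tail a 0 = suminf a"
  by (simp add: tail_def)

lemma summable_shift:
  fixes a :: "nat \<Rightarrow> real"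
  assumes "summable a"
  shows "summable (\<lambda>j. a (k + j))"
  using summable_ignore_initial_segment[OF assms, of k] by (simp add: add.commute)

lemma tail_split:
  assumes "summable a"
  shows "tail a m = (\<Sum>j<i. a (m + j)) + tail a (m + i)"
  using suminf_split_initial_segment[OF summable_shift[OF assms, of m], of i]
  by (simp add: tail_def ac_simps)

lemma tail_tendsto_0:
  assumes "summable a"
  shows "tail a \<longlonglongrightarrow> 0"
proof -
  have "(\<lambda>n. suminf a - (\<Sum>j<n. a j)) \<longlonglongrightarrow> suminf a - suminf a"
    by (intro tendsto_intros summable_LIMSEQ assms)
  moreover have "suminf a - (\<Sum>j<n. a j) = tail a n" for n
    using tail_split[OF assms, of 0 n] by (simp add: tail_0)
  ultimately show ?thesis by simp
qed

lemma log_concave_nat_tail_ratio: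
  assumes "log_concave_nat a" "summable a"
  shows "a m * tail a (m + i + k) \<le> tail a (m + i) * a (m + k)"
proof -
  have "a m * tail a (m + i + k) = (\<Sum>j. a m * a (m + (i + j) + k))"
    unfolding tail_def
    by (subst suminf_mult[symmetric]) (auto intro: summable_shift assms simp: ac_simps)
  also have "\<dots> \<le> (\<Sum>j. a (m + (i + j)) * a (m + k))"
  proof (rule suminf_le)
    show "summable (\<lambda>j. a m * a (m + (i + j) + k))"
      using summable_mult[OF summable_shift[OF assms(2), of "m + i + k"], of "a m"]
      by (simp add: ac_simps)
    show "summable (\<lambda>j. a (m + (i + j)) * a (m + k))"
      using summable_mult2[OF summable_shift[OF assms(2), of "m + i"], of "a (m + k)"]
      by (simp add: ac_simps)
  qed (rule log_concave_natD(2)[OF assms(1)])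
  also have "\<dots> = tail a (m + i) * a (m + k)"
    unfolding tail_def
    by (subst suminf_mult2) (auto intro: summable_shift assms simp: ac_simps)
  finally show ?thesis .
qed

text \<open>Both \<open>tail a m\<close> and \<open>tail a (m + k)\<close> exceed the tails that start \<open>i\<close> places later by a
  block of \<open>i\<close> terms. The product of the two later tails cancels, and the blocks compare term by
  term by the previous lemma.\<close>

lemma log_concave_nat_tail:
  assumes "log_concave_nat a" "summable a"
  shows "log_concave_nat (tail a)"
  unfolding log_concave_nat_def
proof (intro conjI allI)
  show "0 \<le> tail a k" for k
    unfolding tail_def
    by (intro suminf_nonneg summable_shift assms log_concave_natD(1)[OF assms(1)])
next
  fix m i k
  have "(\<Sum>j<i. a (m + j)) * tail a (m + i + k) \<le> tail a (m + i) * (\<Sum>j<i. a (m + k + j))"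
    unfolding sum_distrib_left sum_distrib_right
  proof (rule sum_mono)
    fix j assume "j \<in> {..<i}"
    then show "a (m + j) * tail a (m + i + k) \<le> tail a (m + i) * a (m + k + j)"
      using log_concave_nat_tail_ratio[OF assms, of "m + j" "i - j" k] by (simp add: ac_simps)
  qed
  then show "tail a m * tail a (m + i + k) \<le> tail a (m + i) * tail a (m + k)"
    using tail_split[OF assms(2), of m i] tail_split[OF assms(2), of "m + k" i]
    by (simp add: algebra_simps)
qed

text \<open>The tails of a log-concave sequence are dominated by a multiple of the sequence itself. This
  is why no separate argument for exponential decay is needed: each further tail sum, and hence each
  moment, converges because the previous one does. The second claim bounds the mean sharply, with
  equality for geometric sequences.\<close>

lemma tail_summable:
  assumes "log_concave_nat a" "summable a" "0 < a 0"
  shows "summable (tail a)" and "a 0 * suminf (tail a) \<le> (suminf a)\<^sup>2"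
proof -
  have bound: "a 0 * tail a k \<le> suminf a * a k" for k
    using log_concave_nat_tail_ratio[OF assms(1,2), of 0 0 k] by (simp add: tail_0)
  have nonneg: "0 \<le> tail a k" for k
    by (rule log_concave_natD(1)[OF log_concave_nat_tail[OF assms(1,2)]])
  show summ: "summable (tail a)"
  proof (rule summable_comparison_test')
    show "summable (\<lambda>k. suminf a / a 0 * a k)"
      by (intro summable_mult assms)
    show "norm (tail a k) \<le> suminf a / a 0 * a k" for k
      using bound[of k] nonneg[of k] assms(3) by (simp add: field_simps)
  qed
  have "a 0 * suminf (tail a) = (\<Sum>k. a 0 * tail a k)"
    by (rule suminf_mult[symmetric, OF summ])
  also have "\<dots> \<le> (\<Sum>k. suminf a * a k)"
    by (intro suminf_le bound summable_mult summ assms)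
  also have "\<dots> = (suminf a)\<^sup>2"
    by (simp add: suminf_mult assms power2_eq_square)
  finally show "a 0 * suminf (tail a) \<le> (suminf a)\<^sup>2" .
qed

text \<open>Weights on the tails turn into accumulated weights on the terms: with weight \<open>1\<close>, then
  \<open>j + 1\<close>, the sums of first and second tails become binomial moments of the sequence.\<close>

lemma sums_by_parts_tail:
  fixes a w :: "nat \<Rightarrow> real"
  assumes a: "\<And>k. 0 \<le> a k" "summable a"
    and w: "\<And>k. 0 \<le> w k"
    and wt: "summable (\<lambda>j. w j * tail a j)"
  shows "(\<lambda>j. (\<Sum>i\<le>j. w i) * a j) sums (\<Sum>j. w j * tail a j)"
proof -
  define b where "b j = (\<Sum>i\<le>j. w i) * a j" for j
  have W_mono: "(\<Sum>i<n. w i) \<le> (\<Sum>i\<le>n + j. w i)" for n j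
    by (rule sum_mono2) (auto simp: w)
  have b_nonneg: "0 \<le> b j" for j
    by (simp add: b_def a w sum_nonneg)
  have tail_nonneg: "0 \<le> tail a k" for k
    unfolding tail_def by (intro suminf_nonneg summable_shift a)
  have parts: "(\<Sum>j<n. b j) + (\<Sum>i<n. w i) * tail a n = (\<Sum>j<n. w j * tail a j)" for n
  proof (induction n)
    case 0
    then show ?case by simp
  next
    case (Suc n)
    have "tail a n = a n + tail a (Suc n)"
      using tail_split[OF a(2), of n 1] by simp
    moreover have "{..n} = insert n {..<n}" by auto
    ultimately show ?case using Suc by (simp add: b_def algebra_simps)
  qed
  have "summable b"
  proof (rule bounded_imp_summable)
    fix n
    have "(\<Sum>j\<le>n. b j) \<le> (\<Sum>j<Suc n. w j * tail a j)"
      unfolding parts[symmetric]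
      by (simp add: sum_nonneg w tail_nonneg flip: lessThan_Suc_atMost)
    also have "\<dots> \<le> (\<Sum>j. w j * tail a j)"
      by (intro sum_le_suminf wt) (auto simp: w tail_nonneg)
    finally show "(\<Sum>j\<le>n. b j) \<le> (\<Sum>j. w j * tail a j)" .
  qed (rule b_nonneg)
  \<comment> \<open>The boundary term vanishes because the convergent series of \<open>b\<close> has tails that dominate it.\<close>
  have "(\<lambda>n. (\<Sum>i<n. w i) * tail a n) \<longlonglongrightarrow> 0"
  proof (rule tendsto_sandwich[OF _ _ tendsto_const tail_tendsto_0[OF \<open>summable b\<close>]])
    show "\<forall>\<^sub>F n in sequentially. 0 \<le> (\<Sum>i<n. w i) * tail a n"
      by (simp add: sum_nonneg w tail_nonneg)
    have "(\<Sum>i<n. w i) * tail a n \<le> tail b n" for n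
    proof -
      have "(\<Sum>i<n. w i) * tail a n = (\<Sum>j. (\<Sum>i<n. w i) * a (n + j))"
        unfolding tail_def by (rule suminf_mult[symmetric, OF summable_shift[OF a(2)]])
      also have "\<dots> \<le> tail b n"
        unfolding tail_def
        by (intro suminf_le summable_mult summable_shift a \<open>summable b\<close>)
          (auto simp: b_def intro!: mult_right_mono a W_mono)
      finally show ?thesis .
    qed
    then show "\<forall>\<^sub>F n in sequentially. (\<Sum>i<n. w i) * tail a n \<le> tail b n" by simp
  qed
  then have "(\<lambda>n. (\<Sum>j<n. w j * tail a j) - (\<Sum>i<n. w i) * tail a n)
      \<longlonglongrightarrow> (\<Sum>j. w j * tail a j) - 0"
    by (intro tendsto_diff summable_LIMSEQ wt)
  moreover have "(\<Sum>j<n. w j * tail a j) - (\<Sum>i<n. w i) * tail a n = (\<Sum>j<n. b j)" for n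
    using parts[of n] by simp
  ultimately have "b sums (\<Sum>j. w j * tail a j)"
    by (simp add: sums_def)
  then show ?thesis unfolding b_def .
qed

section \<open>Moments of one half, and the inequality for both halves\<close>

text \<open>With \<open>S2\<close> and \<open>S3\<close> the sums of \<open>j + 1\<close> and of \<open>(j + 1) * (j + 2) / 2\<close> against \<open>a\<close>, which are
  the sums of its first and second tails, the two bounds say that
  \<open>a 0 * S2 \<le> A\<^sup>2\<close> and \<open>A * S3 \<le> S2\<^sup>2\<close>: the iterated tail sums at \<open>0\<close> form again a log-concave
  sequence. They are rewritten here in terms of the ordinary moments.\<close>

lemma log_concave_nat_moments:
  assumes lc: "log_concave_nat a" and summ: "summable a" and pos: "0 < a 0"
  obtains s Q where "(\<lambda>j. real j * a j) sums s" and "(\<lambda>j. (real j)\<^sup>2 * a j) sums Q"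
    and "a 0 * s \<le> suminf a * (suminf a - a 0)" and "suminf a * Q \<le> 2 * s\<^sup>2 + suminf a * s"
proof -
  define T where "T = tail a"
  define A where "A = suminf a"
  define S2 where "S2 = suminf T"
  define S3 where "S3 = suminf (tail T)"
  have lcT: "log_concave_nat T" unfolding T_def by (rule log_concave_nat_tail[OF lc summ])
  have sT: "summable T" unfolding T_def by (rule tail_summable[OF lc summ pos])
  have T0: "T 0 = A" by (simp add: T_def A_def tail_0)
  have "0 < A"
    unfolding A_def by (rule suminf_pos2[OF summ, of 0]) (auto simp: pos log_concave_natD[OF lc])
  then have posT: "0 < T 0" by (simp add: T0)
  have sTT: "summable (tail T)" by (rule tail_summable[OF lcT sT posT])
  have a_nonneg: "0 \<le> a k" for k by (rule log_concave_natD(1)[OF lc])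
  have T_nonneg: "0 \<le> T k" for k by (rule log_concave_natD(1)[OF lcT])
  \<comment> \<open>\<open>S2\<close> and \<open>S3\<close> were defined as sums of tails; they are binomial moments of \<open>a\<close>.\<close>
  have e2: "(\<lambda>j. real (j + 1) * a j) sums S2"
    using sums_by_parts_tail[of a "\<lambda>_. 1"] a_nonneg summ sT
    by (simp add: S2_def T_def add.commute)
  have e3': "(\<lambda>j. real (j + 1) * T j) sums S3"
    using sums_by_parts_tail[of T "\<lambda>_. 1"] T_nonneg sT sTT
    by (simp add: S3_def add.commute)
  have tri: "(\<Sum>i\<le>j. real (i + 1)) = real ((j + 1) * (j + 2)) / 2" for j
    by (induction j) (auto simp: field_simps)
  have e3: "(\<lambda>j. real ((j + 1) * (j + 2)) / 2 * a j) sums S3"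
    using sums_by_parts_tail[of a "\<lambda>j. real (j + 1)"] a_nonneg summ e3'
    unfolding tri T_def[symmetric] by (auto simp: sums_iff)
  have e1: "a sums A" unfolding A_def by (rule summable_sums[OF summ])
  have s: "(\<lambda>j. real j * a j) sums (S2 - A)"
    using sums_diff[OF e2 e1] by (simp add: algebra_simps)
  have "(\<lambda>j. 2 * (real ((j + 1) * (j + 2)) / 2 * a j) - 3 * (real (j + 1) * a j) + a j)
      sums (2 * S3 - 3 * S2 + A)"
    by (intro sums_add sums_diff sums_mult e1 e2 e3)
  also have "(\<lambda>j. 2 * (real ((j + 1) * (j + 2)) / 2 * a j) - 3 * (real (j + 1) * a j) + a j)
      = (\<lambda>j. (real j)\<^sup>2 * a j)"
    by (auto simp: field_simps power2_eq_square)
  finally have Q: "(\<lambda>j. (real j)\<^sup>2 * a j) sums (2 * S3 - 3 * S2 + A)" .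
  have "a 0 * S2 \<le> A\<^sup>2"
    using tail_summable(2)[OF lc summ pos] by (simp add: S2_def T_def A_def)
  moreover have "A * S3 \<le> S2\<^sup>2"
    using tail_summable(2)[OF lcT sT posT] by (simp add: S2_def S3_def T0)
  ultimately have "a 0 * (S2 - A) \<le> A * (A - a 0)"
      "A * (2 * S3 - 3 * S2 + A) \<le> 2 * (S2 - A)\<^sup>2 + A * (S2 - A)"
    by (simp_all add: algebra_simps power2_eq_square)
  then show ?thesis using that[OF s Q] by (simp add: A_def)
qed

text \<open>The mean must not be estimated by itself, since it is the variance that is bounded: the
  negative square \<open>- (s - t)\<^sup>2\<close> is kept and its parts \<open>- s\<^sup>2\<close> and \<open>- t\<^sup>2\<close> are absorbed by
  \<open>2 * s\<^sup>2 / A\<close> and \<open>2 * t\<^sup>2 / B\<close>. The upper bounds for \<open>s\<close> and \<open>t\<close> are used only afterwards, when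
  the expression is monotone in both.\<close>

lemma two_sided_bound:
  fixes M A B s t Q R :: real
  assumes M: "0 < M" "M \<le> A" "M \<le> B" and AB: "A + B = 1 + M"
    and s: "0 \<le> s" "M * s \<le> A * (A - M)" "A * Q \<le> 2 * s\<^sup>2 + A * s"
    and t: "0 \<le> t" "M * t \<le> B * (B - M)" "B * R \<le> 2 * t\<^sup>2 + B * t"
  shows "M\<^sup>2 * (Q + R - (s - t)\<^sup>2) + M \<le> 1"
proof -
  have pos: "0 < A" "0 < B" "A \<le> 1" "B \<le> 1" using M AB by auto
  \<comment> \<open>In this normalisation the constraints on \<open>s\<close> and \<open>t\<close> become \<open>x \<le> A - M\<close> and \<open>y \<le> B - M\<close>,
    with equality for the geometric sequences.\<close>
  define x where "x = M * s / A"
  define y where "y = M * t / B"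
  have x: "M * s = A * x" "0 \<le> x" "x \<le> A - M"
    using pos M s by (auto simp: x_def field_simps)
  have y: "M * t = B * y" "0 \<le> y" "y \<le> B - M"
    using pos M t by (auto simp: y_def field_simps)
  have side: "M\<^sup>2 * q \<le> 2 * C * z\<^sup>2 + M * C * z"
    if "0 < C" "C * q \<le> 2 * u\<^sup>2 + C * u" "M * u = C * z" for C q u z :: real
  proof -
    have "C * (M\<^sup>2 * q) = M\<^sup>2 * (C * q)" by simp
    also have "\<dots> \<le> M\<^sup>2 * (2 * u\<^sup>2 + C * u)" by (intro mult_left_mono that) simp
    also have "\<dots> = 2 * (M * u)\<^sup>2 + M * C * (M * u)" by (simp add: algebra_simps power2_eq_square)
    also have "\<dots> = C * (2 * C * z\<^sup>2 + M * C * z)"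
      unfolding that by (simp add: algebra_simps power2_eq_square)
    finally show ?thesis using that(1) by simp
  qed
  define a where "a = A - M"
  define b where "b = B - M"
  have ab: "0 \<le> a" "0 \<le> b" "M = 1 - a - b" "A = 1 - b" "B = 1 - a"
    using M AB by (auto simp: a_def b_def)
  have "M\<^sup>2 * (Q + R - (s - t)\<^sup>2) = M\<^sup>2 * Q + M\<^sup>2 * R - (M * s - M * t)\<^sup>2"
    by (simp add: algebra_simps power2_eq_square)
  also have "\<dots> \<le> (2 * A * x\<^sup>2 + M * A * x) + (2 * B * y\<^sup>2 + M * B * y) - (A * x - B * y)\<^sup>2"
    using side[OF pos(1) s(3) x(1)] side[OF pos(2) t(3) y(1)] by (simp add: x(1) y(1))
  also have "\<dots> = A * (2 - A) * x\<^sup>2 + B * (2 - B) * y\<^sup>2 + 2 * A * B * (x * y)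
      + M * A * x + M * B * y"
    by (simp add: algebra_simps power2_eq_square)
  also have "\<dots> \<le> A * (2 - A) * a\<^sup>2 + B * (2 - B) * b\<^sup>2 + 2 * A * B * (a * b)
      + M * A * a + M * B * b"
    using x y pos M ab(1,2) unfolding a_def b_def
    by (intro add_mono mult_left_mono mult_mono power_mono) auto
  also have "\<dots> = a + b - 2 * a * b"
    unfolding ab(3-5) by (simp add: algebra_simps power2_eq_square)
  also have "\<dots> \<le> 1 - M" using ab(1,2) mult_nonneg_nonneg[OF ab(1,2)] by (simp add: ab(3))
  finally show ?thesis by simp
qed

section \<open>Integer-valued random variables\<close>

lemma has_sum_int_halves:
  fixes h :: "int \<Rightarrow> real"
  assumes U: "(\<lambda>j. h (int j)) sums U" "summable (\<lambda>j. norm (h (int j)))"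
    and V: "(\<lambda>j. h (- int j)) sums V" "summable (\<lambda>j. norm (h (- int j)))"
  shows "(h has_sum (U + V - h 0)) UNIV"
proof -
  have "bij_betw int UNIV {0..}"
    by (rule bij_betwI[of _ _ _ nat]) auto
  then have right: "(h has_sum U) {0..}"
    using norm_summable_imp_has_sum[OF U(2,1)] has_sum_reindex_bij_betw by blast
  have "bij_betw (\<lambda>j. - int j) UNIV {..0}"
    by (rule bij_betwI[of _ _ _ "\<lambda>k. nat (- k)"]) auto
  then have "(h has_sum V) {..0}"
    using norm_summable_imp_has_sum[OF V(2,1)] has_sum_reindex_bij_betw[of "\<lambda>j. - int j"] by blast
  then have left: "(h has_sum (V - h 0)) ({..0} - {0})"
    by (rule has_sum_Diff) (auto intro!: has_sum_finiteI)
  have "(h has_sum (U + (V - h 0))) ({0..} \<union> ({..0} - {0}))"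
    by (rule has_sum_Un_disjoint[OF right left]) auto
  moreover have "{0..} \<union> ({..0} - {0}) = (UNIV :: int set)" by auto
  ultimately show ?thesis by (simp add: algebra_simps)
qed

context prob_space
begin

lemma prob_mass_nonneg: "0 \<le> prob_mass M X k"
  by (simp add: prob_mass_def)

lemma distributed_prob_mass:
  assumes "X \<in> measurable M (count_space UNIV)"
  shows "distributed M (count_space UNIV) X (\<lambda>k. ennreal (prob_mass M X k))"
  unfolding distributed_def
proof (intro conjI assms)
  show "distr M (count_space UNIV) X
      = density (count_space UNIV) (\<lambda>k. ennreal (prob_mass M X k))"
  proof (rule measure_eqI_countable[where A = UNIV])
    fix k :: int
    have "X -` {k} \<inter> space M = {\<omega> \<in> space M. X \<omega> = k}" by auto
    then show "emeasure (distr M (count_space UNIV) X) {k}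
        = emeasure (density (count_space UNIV) (\<lambda>k. ennreal (prob_mass M X k))) {k}"
      using assms
      by (simp add: emeasure_distr emeasure_density nn_integral_count_space_indicator[symmetric]
          emeasure_eq_measure prob_mass_def)
  qed auto
qed auto

lemma integrable_iff_prob_mass:
  assumes "X \<in> measurable M (count_space UNIV)"
  shows "integrable M (\<lambda>\<omega>. g (X \<omega>)) \<longleftrightarrow>
    (\<lambda>k. norm (prob_mass M X k * (g k :: real))) summable_on UNIV"
  unfolding abs_summable_equivalent[unfolded abs_summable_on_def]
  by (rule distributed_integrable[symmetric, OF distributed_prob_mass[OF assms]])
    (auto simp: prob_mass_nonneg)

lemma expectation_prob_mass:
  assumes X: "X \<in> measurable M (count_space UNIV)"
    and g: "integrable M (\<lambda>\<omega>. g (X \<omega>) :: real)"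
  shows "expectation (\<lambda>\<omega>. g (X \<omega>)) = infsum (\<lambda>k. prob_mass M X k * g k) UNIV"
proof -
  have "infsetsum (\<lambda>k. prob_mass M X k * g k) UNIV = expectation (\<lambda>\<omega>. g (X \<omega>))"
    unfolding infsetsum_def
    by (rule distributed_integral[OF distributed_prob_mass[OF X]]) (auto simp: prob_mass_nonneg)
  with g show ?thesis
    unfolding integrable_iff_prob_mass[OF X] abs_summable_equivalent
    by (simp add: infsetsum_infsum)
qed

lemma prob_mass_has_sum_1:
  assumes "X \<in> measurable M (count_space UNIV)"
  shows "(prob_mass M X has_sum 1) UNIV"
proof -
  have "infsum (prob_mass M X) UNIV = 1"
    using expectation_prob_mass[OF assms, of "\<lambda>_. 1"] by (simp add: prob_space)
  moreover have "prob_mass M X summable_on UNIV"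
    using integrable_iff_prob_mass[OF assms, of "\<lambda>_. 1"] by (simp add: prob_mass_nonneg)
  ultimately show ?thesis by (simp add: has_sum_iff)
qed

lemma expectation_int_halves:
  fixes g :: "int \<Rightarrow> real"
  assumes X: "X \<in> measurable M (count_space UNIV)"
    and U: "(\<lambda>j. prob_mass M X (int j) * g (int j)) sums U"
      "summable (\<lambda>j. norm (prob_mass M X (int j) * g (int j)))"
    and V: "(\<lambda>j. prob_mass M X (- int j) * g (- int j)) sums V"
      "summable (\<lambda>j. norm (prob_mass M X (- int j) * g (- int j)))"
  shows "integrable M (\<lambda>\<omega>. g (X \<omega>))"
    and "expectation (\<lambda>\<omega>. g (X \<omega>)) = U + V - prob_mass M X 0 * g 0"
proof -
  define h where "h k = prob_mass M X k * g k" for k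
  have h: "(h has_sum (U + V - h 0)) UNIV"
    by (rule has_sum_int_halves) (use U V in \<open>simp_all add: h_def\<close>)
  have "((\<lambda>k. norm (h k)) has_sum
      ((\<Sum>j. norm (h (int j))) + (\<Sum>j. norm (h (- int j))) - norm (h 0))) UNIV"
    by (rule has_sum_int_halves) (use U V in \<open>simp_all add: h_def summable_sums\<close>)
  then have "(\<lambda>k. norm (h k)) summable_on UNIV"
    unfolding summable_on_def by blast
  then show int: "integrable M (\<lambda>\<omega>. g (X \<omega>))"
    unfolding integrable_iff_prob_mass[OF X] h_def .
  show "expectation (\<lambda>\<omega>. g (X \<omega>)) = U + V - prob_mass M X 0 * g 0"
    using expectation_prob_mass[OF X int] infsumI[OF h] by (simp add: h_def[abs_def])
qed

text \<open>Only finitely many points carry a mass at least as large as a given positive one, because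
  the masses add up to \<open>1\<close>.\<close>

lemma prob_mass_attains_max:
  assumes X: "X \<in> measurable M (count_space UNIV)"
  obtains k0 where "0 < prob_mass M X k0" "\<And>k. prob_mass M X k \<le> prob_mass M X k0"
proof -
  define p where "p = prob_mass M X"
  have p: "(p has_sum 1) UNIV" unfolding p_def by (rule prob_mass_has_sum_1[OF X])
  have nonneg: "0 \<le> p k" for k unfolding p_def by (rule prob_mass_nonneg)
  have "\<exists>k. p k \<noteq> 0"
  proof (rule ccontr)
    assume "\<not> (\<exists>k. p k \<noteq> 0)"
    then have "(p has_sum 0) UNIV" by (intro has_sum_0) auto
    with p show False using has_sum_unique by fastforce
  qed
  then obtain k1 where k1: "0 < p k1" using nonneg by (metis less_eq_real_def)
  define S where "S = {k. p k1 \<le> p k}"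
  have "finite S"
  proof (rule ccontr)
    assume inf: "infinite S"
    obtain n :: nat where n: "1 < real n * p k1"
      using reals_Archimedean3[OF k1] by blast
    obtain F where F: "finite F" "card F = n" "F \<subseteq> S"
      using infinite_arbitrarily_large[OF inf] by blast
    have "real n * p k1 = (\<Sum>k\<in>F. p k1)" by (simp add: F)
    also have "\<dots> \<le> sum p F" by (intro sum_mono) (use F in \<open>auto simp: S_def\<close>)
    also have "\<dots> \<le> 1" by (rule finite_sum_le_has_sum[OF p F(1)]) (auto simp: nonneg)
    finally show False using n by simp
  qed
  have "k1 \<in> S" by (simp add: S_def)
  then have "Max (p ` S) \<in> p ` S" using \<open>finite S\<close> by (intro Max_in) auto
  then obtain k0 where k0: "k0 \<in> S" "p k0 = Max (p ` S)" by auto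
  then have k0_max: "p k \<le> p k0" if "k \<in> S" for k
    using that \<open>finite S\<close> by simp
  have "p k \<le> p k0" for k
    by (cases "k \<in> S") (use k0_max \<open>k1 \<in> S\<close> in \<open>force simp: S_def\<close>)+
  moreover have "0 < p k0" using k1 k0(1) by (simp add: S_def)
  ultimately show ?thesis using that unfolding p_def by blast
qed

text \<open>The comparison with geometric sequences works from every point of the support, not just from
  a mode; a mode gives the strongest inequality.\<close>

lemma variance_bound_at_0:
  assumes X: "X \<in> measurable M (count_space UNIV)"
    and lc: "log_concave_seq (prob_mass M X)"
    and pos_0: "0 < prob_mass M X 0"
  shows "integrable M (\<lambda>\<omega>. real_of_int (X \<omega>))"
    and "integrable M (\<lambda>\<omega>. (real_of_int (X \<omega>))\<^sup>2)"
    and "(prob_mass M X 0)\<^sup>2 * variance (\<lambda>\<omega>. real_of_int (X \<omega>)) + prob_mass M X 0 \<le> 1"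
proof -
  define p where "p = prob_mass M X"
  define a where "a j = p (int j)" for j
  define b where "b j = p (- int j)" for j
  have nonneg: "0 \<le> p k" for k unfolding p_def by (rule prob_mass_nonneg)
  have p: "(p has_sum 1) UNIV" unfolding p_def by (rule prob_mass_has_sum_1[OF X])
  have local_ineq: "p (k + 1) * p (k - 1) \<le> (p k)\<^sup>2" for k
    using lc unfolding log_concave_seq_def p_def by blast
  have no_gap: "0 < p j" if "0 < p i" "0 < p k" "i \<le> j" "j \<le> k" for i j k
    using lc that unfolding log_concave_seq_def discrete_interval_def p_def by blast
  have lca: "log_concave_nat a"
  proof (rule log_concave_natI_local)
    show "a k * a (k + 2) \<le> (a (k + 1))\<^sup>2" for k
    proof -
      have "int (k + 1) + 1 = int (k + 2)" "int (k + 1) - 1 = int k" by simp_all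
      with local_ineq[of "int (k + 1)"] show ?thesis unfolding a_def by (simp only: mult.commute)
    qed
    show "0 < a j" if "0 < a i" "0 < a k" "i \<le> j" "j \<le> k" for i j k
      using no_gap[of "int i" "int k" "int j"] that by (simp add: a_def)
  qed (simp add: a_def nonneg)
  have lcb: "log_concave_nat b"
  proof (rule log_concave_natI_local)
    show "b k * b (k + 2) \<le> (b (k + 1))\<^sup>2" for k
    proof -
      have "- int (k + 1) + 1 = - int k" "- int (k + 1) - 1 = - int (k + 2)" by simp_all
      with local_ineq[of "- int (k + 1)"] show ?thesis unfolding b_def by (simp only:)
    qed
    show "0 < b j" if "0 < b i" "0 < b k" "i \<le> j" "j \<le> k" for i j k
      using no_gap[of "- int k" "- int i" "- int j"] that by (simp add: b_def)
  qed (simp add: b_def nonneg)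
  have "p summable_on range int" "p summable_on range (\<lambda>j. - int j)"
    by (rule summable_on_subset[of p UNIV]; use p in \<open>auto simp: summable_on_def\<close>)+
  then have "a summable_on UNIV" "b summable_on UNIV"
    by (simp_all add: summable_on_reindex inj_on_def o_def a_def[abs_def] b_def[abs_def])
  then have sa: "summable a" and sb: "summable b"
    by (simp_all add: summable_on_imp_summable)
  define A where "A = suminf a"
  define B where "B = suminf b"
  have "(\<lambda>j. p (int j)) sums A" "(\<lambda>j. p (- int j)) sums B"
    "summable (\<lambda>j. norm (p (int j)))" "summable (\<lambda>j. norm (p (- int j)))"
    using sa sb by (simp_all add: A_def B_def a_def[abs_def] b_def[abs_def] nonneg summable_sums)
  then have "(p has_sum (A + B - p 0)) UNIV" by (intro has_sum_int_halves)
  then have AB: "A + B = 1 + p 0" using has_sum_unique[OF p] by fastforce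
  have a0: "a 0 = p 0" "b 0 = p 0" by (simp_all add: a_def b_def)
  have a_nonneg: "0 \<le> a j" "0 \<le> b j" for j by (simp_all add: a_def b_def nonneg)
  have pos: "0 < p 0" unfolding p_def by (rule pos_0)
  have le: "p 0 \<le> A" "p 0 \<le> B"
    using sum_le_suminf[OF sa, of "{0}"] sum_le_suminf[OF sb, of "{0}"] a_nonneg a0
    by (simp_all add: A_def B_def)
  obtain s Q where s: "(\<lambda>j. real j * a j) sums s" "(\<lambda>j. (real j)\<^sup>2 * a j) sums Q"
    "p 0 * s \<le> A * (A - p 0)" "A * Q \<le> 2 * s\<^sup>2 + A * s"
    by (rule log_concave_nat_moments[OF lca sa, unfolded a0, OF pos, folded A_def])
  obtain t R where t: "(\<lambda>j. real j * b j) sums t" "(\<lambda>j. (real j)\<^sup>2 * b j) sums R"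
    "p 0 * t \<le> B * (B - p 0)" "B * R \<le> 2 * t\<^sup>2 + B * t"
    by (rule log_concave_nat_moments[OF lcb sb, unfolded a0, OF pos, folded B_def])
  have st: "0 \<le> s" "0 \<le> t"
    using sums_le[OF _ sums_zero s(1)] sums_le[OF _ sums_zero t(1)] a_nonneg by auto
  have first: "(\<lambda>j. prob_mass M X (int j) * real_of_int (int j)) sums s"
      "summable (\<lambda>j. norm (prob_mass M X (int j) * real_of_int (int j)))"
      "(\<lambda>j. prob_mass M X (- int j) * real_of_int (- int j)) sums (- t)"
      "summable (\<lambda>j. norm (prob_mass M X (- int j) * real_of_int (- int j)))"
    using s(1) sums_minus[OF t(1)] sums_summable[OF s(1)] sums_summable[OF t(1)]
    by (simp_all add: a_def b_def p_def abs_mult prob_mass_nonneg mult.commute)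
  have second: "(\<lambda>j. prob_mass M X (int j) * (real_of_int (int j))\<^sup>2) sums Q"
      "summable (\<lambda>j. norm (prob_mass M X (int j) * (real_of_int (int j))\<^sup>2))"
      "(\<lambda>j. prob_mass M X (- int j) * (real_of_int (- int j))\<^sup>2) sums R"
      "summable (\<lambda>j. norm (prob_mass M X (- int j) * (real_of_int (- int j))\<^sup>2))"
    using s(2) t(2) sums_summable[OF s(2)] sums_summable[OF t(2)]
    by (simp_all add: a_def b_def p_def abs_mult prob_mass_nonneg mult.commute)
  have E1: "integrable M (\<lambda>\<omega>. real_of_int (X \<omega>))"
      "expectation (\<lambda>\<omega>. real_of_int (X \<omega>)) = s - t"
    using expectation_int_halves[OF X first] by simp_all
  have E2: "integrable M (\<lambda>\<omega>. (real_of_int (X \<omega>))\<^sup>2)"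
      "expectation (\<lambda>\<omega>. (real_of_int (X \<omega>))\<^sup>2) = Q + R"
    using expectation_int_halves[OF X second] by simp_all
  show "integrable M (\<lambda>\<omega>. real_of_int (X \<omega>))" "integrable M (\<lambda>\<omega>. (real_of_int (X \<omega>))\<^sup>2)"
    by (fact E1(1) E2(1))+
  have "variance (\<lambda>\<omega>. real_of_int (X \<omega>)) = Q + R - (s - t)\<^sup>2"
    using variance_eq[OF E1(1) E2(1)] unfolding E1(2) E2(2) .
  then show "(prob_mass M X 0)\<^sup>2 * variance (\<lambda>\<omega>. real_of_int (X \<omega>)) + prob_mass M X 0 \<le> 1"
    using two_sided_bound[OF pos le AB st(1) s(3,4) st(2) t(3,4)] by (simp add: p_def)
qed

end

lemma log_concave_seq_shift:
  assumes "log_concave_seq p"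
  shows "log_concave_seq (\<lambda>k. p (k + c))"
proof -
  have interval: "0 < p j" if "0 < p i" "0 < p k" "i \<le> j" "j \<le> k" for i j k
    using assms that unfolding log_concave_seq_def discrete_interval_def by blast
  have "discrete_interval {k. 0 < p (k + c)}"
    unfolding discrete_interval_def
  proof (intro ballI allI impI)
    fix i k j assume "i \<in> {k. 0 < p (k + c)}" "k \<in> {k. 0 < p (k + c)}" "i \<le> j \<and> j \<le> k"
    then show "j \<in> {k. 0 < p (k + c)}"
      using interval[of "i + c" "k + c" "j + c"] by simp
  qed
  moreover have "p (k + 1 + c) * p (k - 1 + c) \<le> (p (k + c))\<^sup>2" for k
  proof -
    have "p (k + c + 1) * p (k + c - 1) \<le> (p (k + c))\<^sup>2"
      using assms unfolding log_concave_seq_def by blast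
    moreover have "k + 1 + c = k + c + 1" "k - 1 + c = k + c - 1" by simp_all
    ultimately show ?thesis by (simp only:)
  qed
  ultimately show ?thesis using assms unfolding log_concave_seq_def by blast
qed

theorem theorem1:
  fixes M :: "'a measure" and X :: "'a \<Rightarrow> int"
  assumes "prob_space M"
    and "X \<in> measurable M (count_space UNIV)"
    and "log_concave_rv M X"
  shows "integrable M (\<lambda>\<omega>. (real_of_int (X \<omega>))\<^sup>2) \<and>
    (max_mass M X)\<^sup>2 * prob_space.variance M (\<lambda>\<omega>. real_of_int (X \<omega>)) + max_mass M X \<le> 1"
proof -
  interpret prob_space M by fact
  obtain k0 where pos: "0 < prob_mass M X k0"
    and k0: "\<And>k. prob_mass M X k \<le> prob_mass M X k0"
    using prob_mass_attains_max[OF assms(2)] by blast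
  have max: "max_mass M X = prob_mass M X k0"
    unfolding max_mass_def by (rule Greatest_equality) (auto simp: k0)
  \<comment> \<open>Translation moves the mode to \<open>0\<close> and changes neither the variance nor log-concavity.\<close>
  define Y where "Y \<omega> = X \<omega> - k0" for \<omega>
  have Y: "Y \<in> measurable M (count_space UNIV)"
    using measurable_compose[OF assms(2), of "\<lambda>k. k - k0" "count_space UNIV"]
    by (simp add: Y_def[abs_def])
  have mass_Y: "prob_mass M Y k = prob_mass M X (k + k0)" for k
    unfolding prob_mass_def Y_def by (simp add: algebra_simps)
  have lcY: "log_concave_seq (prob_mass M Y)"
    using log_concave_seq_shift[of "prob_mass M X" k0] assms(3)
    unfolding log_concave_rv_def mass_Y[abs_def] by blast
  note bound = variance_bound_at_0[OF Y lcY, unfolded mass_Y add_0, OF pos]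
  have X_Y: "real_of_int (X \<omega>) = real_of_int k0 + real_of_int (Y \<omega>)" for \<omega>
    by (simp add: Y_def)
  have "integrable M (\<lambda>\<omega>. (real_of_int k0)\<^sup>2 + 2 * real_of_int k0 * real_of_int (Y \<omega>)
      + (real_of_int (Y \<omega>))\<^sup>2)"
    using bound(1,2) by auto
  then have "integrable M (\<lambda>\<omega>. (real_of_int (X \<omega>))\<^sup>2)"
    unfolding X_Y by (simp add: power2_sum algebra_simps)
  moreover have "variance (\<lambda>\<omega>. real_of_int (X \<omega>)) = variance (\<lambda>\<omega>. real_of_int (Y \<omega>))"
    unfolding X_Y
    using bound(1) by (simp add: prob_space)
  ultimately show ?thesis using bound(3) unfolding max by simp
qed

end
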